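(* Let $d\geq 1$ and let $X$ be a simplicial complex on a vertex set of size $n$ whose set of missing faces $\mathcal{M}$ is a partial Steiner $(d,d+1,n)$-system. Then $X$ cannot be written as the intersection of fewer than $|\mathcal{M}|$ $d$-Leray complexes (on the same vertex set). As a consequence, $\operatorname{box}_d(X)=|\mathcal{M}|$.
   Context: A missing face of a simplicial complex $X$ on vertex set $V$ is a set $\tau\subset V$ with $\tau\notin X$ but $\sigma\in X$ for every $\sigma\subsetneq\tau$. A family of $(d+1)$-subsets of an $n$-set $V$ is a partial Steiner $(d,d+1,n)$-system if every $d$-subset of $V$ is contained in at most one member of the family. Fix a field $\mathbb{F}$; $\tilde H_k$ denotes reduced homology with coefficients in $\mathbb{F}$. For $U\subset V$, the induced subcomplex is $X[U]=\{\sigma\in X:\sigma\subset U\}$. $X$ is $d$-Leray if $\tilde H_k(X[U])=0$ for all $U\subset V$ and all $k\geq d$. The nerve of a family $\{F_1,\dots,F_n\}$ is $\{\sigma\subset[n]:\bigcap_{i\in\sigma}F_i\neq\emptyset\}$; $X$ is $d$-representable if it is isomorphic to the nerve of a finite family of compact convex sets in $\mathbb{R}^d$. $\operatorname{box}_d(X)$ is the minimal $k$ such that $X$ is the intersection of $k$ $d$-representable complexes on vertex set $V$. *)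

theory Defs
  imports
    "HOL-Analysis.Analysis"
    "HOL-Algebra.Elementary_Groups"
    "HOL-Library.Extended_Nat"
begin

section \<open>Simplicial complexes\<close>

text \<open>
  Points of \<open>V\<close> need not be vertices of the complex, so a singleton may be a missing face.
\<close>

definition abstract_simplicial_complex :: "'a set \<Rightarrow> 'a set set \<Rightarrow> bool" where
  "abstract_simplicial_complex V X \<longleftrightarrow>
     finite V \<and> X \<subseteq> Pow V \<and> {} \<in> X \<and> (\<forall>\<sigma>\<in>X. \<forall>\<tau>. \<tau> \<subseteq> \<sigma> \<longrightarrow> \<tau> \<in> X)"

definition missing_faces :: "'a set \<Rightarrow> 'a set set \<Rightarrow> 'a set set" where
  "missing_faces V X = {\<tau>. \<tau> \<subseteq> V \<and> \<tau> \<notin> X \<and> (\<forall>\<sigma>. \<sigma> \<subset> \<tau> \<longrightarrow> \<sigma> \<in> X)}"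

definition induced_subcomplex :: "'a set set \<Rightarrow> 'a set \<Rightarrow> 'a set set" where
  "induced_subcomplex X U = {\<sigma> \<in> X. \<sigma> \<subseteq> U}"

definition partial_steiner_system :: "nat \<Rightarrow> nat \<Rightarrow> 'a set \<Rightarrow> 'a set set \<Rightarrow> bool" where
  "partial_steiner_system d n V \<M> \<longleftrightarrow>
     finite V \<and> card V = n \<and>
     (\<forall>\<tau>\<in>\<M>. \<tau> \<subseteq> V \<and> card \<tau> = d + 1) \<and>
     (\<forall>\<sigma>. \<sigma> \<subseteq> V \<and> card \<sigma> = d \<longrightarrow>
        (\<forall>\<tau>\<in>\<M>. \<forall>\<tau>'\<in>\<M>. \<sigma> \<subseteq> \<tau> \<and> \<sigma> \<subseteq> \<tau>' \<longrightarrow> \<tau> = \<tau>'))"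


section \<open>Reduced simplicial homology over a field\<close>

text \<open>
  Oriented chains, with no ordering of the vertices chosen: a list of \<open>k + 1\<close> distinct vertices
  spanning a face is an oriented \<open>k\<close>-simplex, and a \<open>k\<close>-chain is the function giving the
  coefficient of each oriented simplex. It changes sign when two neighbouring vertices are
  exchanged, hence transforms by the sign under every permutation of the list. The empty list
  spans the face \<open>{}\<close>, which makes the complex the augmented one; for \<open>k < -1\<close> the only chain
  is 0.
\<close>

definition simplicial_chains :: "int \<Rightarrow> 'a set set \<Rightarrow> ('a list \<Rightarrow> 'f::field) set" where
  "simplicial_chains k X =
     {c. (\<forall>xs. c xs \<noteq> 0 \<longrightarrow> distinct xs \<and> set xs \<in> X \<and> int (length xs) = k + 1) \<and>
         (\<forall>xs u v ys. c (xs @ u # v # ys) = - c (xs @ v # u # ys))}"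

definition simplicial_chain_group :: "int \<Rightarrow> 'a set set \<Rightarrow> ('a list \<Rightarrow> 'f::field) monoid" where
  "simplicial_chain_group k X =
     \<lparr>carrier = simplicial_chains k X, mult = (\<lambda>c c' xs. c xs + c' xs), one = (\<lambda>xs. 0)\<rparr>"

text \<open>
  This is \<open>\<partial>[v\<^sub>0,\<dots>,v\<^sub>k] = (\<Sum>i. (-1)^i [v\<^sub>0,\<dots>,v\<^sub>i\<^sub>-\<^sub>1,v\<^sub>i\<^sub>+\<^sub>1,\<dots>,v\<^sub>k])\<close> read on coefficients: the
  oriented simplex \<open>ys\<close> occurs in the boundary of \<open>v # ys\<close> with coefficient 1.
\<close>

definition simplicial_boundary :: "('a list \<Rightarrow> 'f::field) \<Rightarrow> 'a list \<Rightarrow> 'f" where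
  "simplicial_boundary c = (\<lambda>ys. \<Sum>v | c (v # ys) \<noteq> 0. c (v # ys))"

definition simplicial_cycles :: "int \<Rightarrow> 'a set set \<Rightarrow> ('a list \<Rightarrow> 'f::field) set" where
  "simplicial_cycles k X =
     kernel (simplicial_chain_group k X) (simplicial_chain_group (k - 1) X) simplicial_boundary"

definition simplicial_boundaries :: "int \<Rightarrow> 'a set set \<Rightarrow> ('a list \<Rightarrow> 'f::field) set" where
  "simplicial_boundaries k X = simplicial_boundary ` simplicial_chains (k + 1) X"

definition reduced_homology ::
    "'f::field itself \<Rightarrow> int \<Rightarrow> 'a set set \<Rightarrow> ('a list \<Rightarrow> 'f) set monoid" where
  "reduced_homology F k X =
     (simplicial_chain_group k X)\<lparr>carrier := simplicial_cycles k X\<rparr> Mod simplicial_boundaries k X"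

definition leray :: "'f::field itself \<Rightarrow> nat \<Rightarrow> 'a set \<Rightarrow> 'a set set \<Rightarrow> bool" where
  "leray F d V X \<longleftrightarrow>
     abstract_simplicial_complex V X \<and>
     (\<forall>U. U \<subseteq> V \<longrightarrow>
        (\<forall>k \<ge> int d. trivial_group (reduced_homology F k (induced_subcomplex X U))))"


section \<open>Representable complexes\<close>

definition nerve :: "'i set \<Rightarrow> ('i \<Rightarrow> 'b set) \<Rightarrow> 'i set set" where
  "nerve I F = {\<sigma>. \<sigma> \<subseteq> I \<and> (\<Inter>i\<in>\<sigma>. F i) \<noteq> {}}"

definition isomorphic_complexes ::
    "'a set \<Rightarrow> 'a set set \<Rightarrow> 'b set \<Rightarrow> 'b set set \<Rightarrow> bool" where
  "isomorphic_complexes V X W Y \<longleftrightarrow>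
     (\<exists>f. bij_betw f V W \<and> (\<forall>\<sigma>. \<sigma> \<subseteq> V \<longrightarrow> (\<sigma> \<in> X \<longleftrightarrow> f ` \<sigma> \<in> Y)))"

text \<open>The type \<open>'d\<close> carries the dimension \<open>d = CARD('d)\<close>.\<close>

definition representable :: "'d::finite itself \<Rightarrow> 'a set \<Rightarrow> 'a set set \<Rightarrow> bool" where
  "representable D V X \<longleftrightarrow>
     abstract_simplicial_complex V X \<and>
     (\<exists>m (F :: nat \<Rightarrow> (real ^ 'd) set).
        (\<forall>i\<in>{1..m}. compact (F i) \<and> convex (F i)) \<and>
        isomorphic_complexes V X {1..m} (nerve {1..m} F))"


section \<open>Intersections of complexes\<close>

text \<open>The intersection of no complexes on \<open>V\<close> is the full simplex \<open>Pow V\<close>.\<close>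

definition is_intersection_of ::
    "('a set set \<Rightarrow> bool) \<Rightarrow> nat \<Rightarrow> 'a set \<Rightarrow> 'a set set \<Rightarrow> bool" where
  "is_intersection_of P k V X \<longleftrightarrow>
     (\<exists>Y :: nat \<Rightarrow> 'a set set. (\<forall>i<k. P (Y i)) \<and> X = Pow V \<inter> (\<Inter>i<k. Y i))"

text \<open>
  An infimum in \<^typ>\<open>enat\<close> is attained if finite, and it is \<open>\<infinity>\<close> if there is no such \<open>k\<close>.
\<close>

definition box_number :: "'d::finite itself \<Rightarrow> 'a set \<Rightarrow> 'a set set \<Rightarrow> enat" where
  "box_number D V X = Inf (enat ` {k. is_intersection_of (representable D V) k V X})"

end

theory Submission
  imports Defs
begin

text \<open>
  If \<open>X\<close> were an intersection of fewer than \<open>|\<M>|\<close> complexes \<open>Y \<supseteq> X\<close>, then by pigeonhole some \<open>Y\<close>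
  would omit two members of \<open>\<M>\<close>, and these would be missing faces of \<open>Y\<close>. Choose two
  distinct missing faces \<open>\<alpha>\<close>, \<open>\<beta>\<close> of \<open>Y\<close> whose union \<open>U\<close> is as small as possible. Then any two missing
  faces inside \<open>U\<close> have union \<open>U\<close>, so their complements in \<open>U\<close> are disjoint: the Alexander dual of
  \<open>Y[U]\<close> is a disjoint union of at least two simplices. The Steiner condition gives \<open>|U| \<ge> d + 3\<close>.

  By Alexander duality \<open>Y[U]\<close> has homology in dimension \<open>|U| - 3 \<ge> d\<close>, so \<open>Y\<close> is not \<open>d\<close>-Leray; the
  cycle is written down explicitly. That \<open>Y\<close> is not \<open>d\<close>-representable either is shown
  without the nerve theorem, by induction on the dimension with Helly's theorem and nearest points.
  For the upper bound on the box number, the complex with a single missing face of size \<open>d + 1\<close> is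
  represented by pieces of the unit cube.
\<close>

section \<open>Disconnected Alexander duals\<close>

text \<open>
  The Alexander dual of \<open>Y[U]\<close> consists of the sets whose complement in \<open>U\<close> is not in \<open>Y\<close>; the
  colouring says that no edge of it joins the two colour classes, both of which contain vertices
  of it.
\<close>

definition separating_colouring :: "'i set set \<Rightarrow> 'i set \<Rightarrow> ('i \<Rightarrow> bool) \<Rightarrow> bool" where
  "separating_colouring Y U f \<longleftrightarrow>
     (\<forall>u\<in>U. \<forall>v\<in>U. f u \<noteq> f v \<longrightarrow> U - {u, v} \<in> Y) \<and>
     (\<exists>u\<in>U. \<exists>v\<in>U. f u \<noteq> f v \<and> U - {u} \<notin> Y \<and> U - {v} \<notin> Y)"

lemma separating_colouring_cong:
  assumes "\<And>\<sigma>. \<sigma> \<subseteq> U \<Longrightarrow> \<sigma> \<in> Y \<longleftrightarrow> \<sigma> \<in> Y'"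
  shows "separating_colouring Y U f \<longleftrightarrow> separating_colouring Y' U f"
  unfolding separating_colouring_def using assms[of "U - _"] by simp

section \<open>Leray complexes\<close>

primrec inversion_sign :: "('a \<Rightarrow> nat) \<Rightarrow> 'a list \<Rightarrow> 'f::field" where
  "inversion_sign r [] = 1"
| "inversion_sign r (x # xs) = (- 1) ^ card {y \<in> set xs. r y < r x} * inversion_sign r xs"

lemma inversion_sign_nonzero: "inversion_sign r xs \<noteq> 0"
  by (induction xs) auto

text \<open>Only the pair \<open>u\<close>, \<open>v\<close> itself becomes or ceases to be an
  inversion; every entry of \<open>xs\<close> sees the same set of later entries.\<close>

lemma inversion_sign_swap:
  assumes "distinct (xs @ u # v # ys)" "r u \<noteq> r v"
  shows "inversion_sign r (xs @ u # v # ys) = - inversion_sign r (xs @ v # u # ys)"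
  using assms(1)
proof (induction xs)
  case Nil
  have *: "{y \<in> set (a # ys). r y < r b} =
      (if r a < r b then insert a {y \<in> set ys. r y < r b} else {y \<in> set ys. r y < r b})" for a b
    by auto
  have "card {y \<in> set (v # ys). r y < r u} = card {y \<in> set ys. r y < r u} + of_bool (r v < r u)"
    "card {y \<in> set (u # ys). r y < r v} = card {y \<in> set ys. r y < r v} + of_bool (r u < r v)"
    using Nil unfolding * by auto
  then show ?case
    using \<open>r u \<noteq> r v\<close> by (cases "r u < r v") (simp_all del: list.set)
next
  case (Cons x xs)
  have "set (xs @ u # v # ys) = set (xs @ v # u # ys)"
    by auto
  then show ?case
    using Cons by (simp del: set_append)
qed

text \<open>Chains are alternating functions on lists, so the simplex \<open>U\<close> needs a
  reference order; \<open>r\<close> supplies it.\<close>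

definition oriented_simplex :: "('a \<Rightarrow> nat) \<Rightarrow> 'a set \<Rightarrow> 'a list \<Rightarrow> 'f::field" where
  "oriented_simplex r U xs = (if distinct xs \<and> set xs = U then inversion_sign r xs else 0)"

lemma oriented_simplex_eq_0_iff: "oriented_simplex r U xs = 0 \<longleftrightarrow> \<not> (distinct xs \<and> set xs = U)"
  by (simp add: oriented_simplex_def inversion_sign_nonzero)

lemma oriented_simplex_swap:
  assumes "inj_on r U"
  shows "oriented_simplex r U (xs @ u # v # ys) = - oriented_simplex r U (xs @ v # u # ys)"
proof (cases "distinct (xs @ u # v # ys) \<and> set (xs @ u # v # ys) = U")
  case True
  then have "r u \<noteq> r v"
    using assms by (auto simp: inj_on_def)
  moreover have "set (xs @ v # u # ys) = set (xs @ u # v # ys)"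
    by auto
  ultimately show ?thesis
    using True inversion_sign_swap[of xs u v ys r] by (auto simp: oriented_simplex_def)
next
  case False
  then have "\<not> (distinct (xs @ v # u # ys) \<and> set (xs @ v # u # ys) = U)"
    by auto
  with False show ?thesis
    by (metis oriented_simplex_eq_0_iff neg_equal_0_iff_equal)
qed

section \<open>Cycles, boundaries and the Leray property\<close>

text \<open>The algebra behind the vanishing of a double boundary. The diagonal has its own
  hypothesis because in characteristic 2 antisymmetry does not make it vanish.\<close>

lemma sum_alternating_eq_0:
  fixes g :: "'a \<Rightarrow> 'a \<Rightarrow> 'b::ab_group_add"
  assumes "finite A" "\<And>x. g x x = 0" "\<And>x y. g x y = - g y x"
  shows "(\<Sum>x\<in>A. \<Sum>y\<in>A. g x y) = 0"
  using assms(1)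
proof (induction A rule: finite_induct)
  case (insert a A)
  have "(\<Sum>x\<in>insert a A. \<Sum>y\<in>insert a A. g x y) =
      (\<Sum>y\<in>A. g a y) + (\<Sum>x\<in>A. g x a) + (\<Sum>x\<in>A. \<Sum>y\<in>A. g x y)"
    using insert assms(2) by (simp add: sum.distrib add.assoc)
  also have "(\<Sum>y\<in>A. g a y) + (\<Sum>x\<in>A. g x a) = (\<Sum>y\<in>A. g a y + g y a)"
    by (simp add: sum.distrib)
  also have "\<dots> = 0"
    using assms(3) by (intro sum.neutral) (metis add.left_inverse)
  finally show ?case
    using insert by simp
qed simp

lemma simplicial_boundary_eq_sum:
  assumes "finite U" "\<And>v. c (v # ys) \<noteq> 0 \<Longrightarrow> v \<in> U"
  shows "simplicial_boundary c ys = (\<Sum>v\<in>U. c (v # ys))"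
  unfolding simplicial_boundary_def using assms
  by (intro sum.mono_neutral_left) auto

text \<open>In a trivial quotient the coset of \<open>z\<close> is the set of boundaries itself, and
  it contains \<open>z\<close> since the zero chain is a boundary.\<close>

lemma cycle_is_boundary:
  assumes "trivial_group (reduced_homology TYPE('f::field) k X)"
    and "z \<in> simplicial_chains k X" "simplicial_boundary z = (\<lambda>_. 0)"
  shows "\<exists>y \<in> simplicial_chains (k + 1) X. (z :: 'a list \<Rightarrow> 'f) = simplicial_boundary y"
proof -
  let ?B = "simplicial_boundaries k X :: ('a list \<Rightarrow> 'f) set"
  let ?G = "(simplicial_chain_group k X)\<lparr>carrier := simplicial_cycles k X\<rparr> :: ('a list \<Rightarrow> 'f) monoid"
  have "z \<in> carrier ?G"
    using assms by (simp add: simplicial_cycles_def kernel_def simplicial_chain_group_def)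
  then have "?B #>\<^bsub>?G\<^esub> z \<in> carrier (?G Mod ?B)"
    by (auto simp: FactGroup_def RCOSETS_def)
  then have coset: "?B #>\<^bsub>?G\<^esub> z = ?B"
    using assms(1) by (auto simp: trivial_group_def reduced_homology_def FactGroup_def)
  have "(\<lambda>_. 0) \<in> ?B"
    unfolding simplicial_boundaries_def
    by (rule image_eqI[of _ _ "\<lambda>_. 0"]) (auto simp: simplicial_boundary_def simplicial_chains_def)
  then have "z \<in> ?B #>\<^bsub>?G\<^esub> z"
    by (force simp: r_coset_def simplicial_chain_group_def)
  then show ?thesis
    unfolding coset by (auto simp: simplicial_boundaries_def)
qed

text \<open>Take \<open>u\<close>, \<open>v\<close> of different colours whose complements in
  \<open>U\<close> are nonfaces. The cycle \<open>z\<close> is nonzero on the orderings of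
  \<open>U - {u, v}\<close>, while the boundary of any chain of the induced complex vanishes
  there.\<close>

lemma leray_no_separating_colouring:
  assumes Y: "leray TYPE('f::field) d V Y" and "U \<subseteq> V" "d + 3 \<le> card U"
  shows "\<not> separating_colouring Y U f"
proof
  assume f: "separating_colouring Y U f"
  have "finite U"
    using Y \<open>U \<subseteq> V\<close> by (auto simp: leray_def abstract_simplicial_complex_def intro: finite_subset)
  from finite_imp_inj_to_nat_seg[OF this] obtain r :: "'a \<Rightarrow> nat" where "inj_on r U"
    by blast
  define e :: "'a list \<Rightarrow> 'f" where "e = oriented_simplex r U"
  have e_0: "e xs = 0 \<longleftrightarrow> \<not> (distinct xs \<and> set xs = U)" for xs
    by (simp add: e_def oriented_simplex_eq_0_iff)
  have e_swap: "e (xs @ u # v # ys) = - e (xs @ v # u # ys)" for xs u v ys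
    unfolding e_def by (rule oriented_simplex_swap[OF \<open>inj_on r U\<close>])
  txt \<open>
    This is the boundary of the chain which is the sum of the faces \<open>U - {v}\<close>, \<open>f v\<close>, of the simplex
    \<open>U\<close>. On a face \<open>U - {u, v}\<close> the two terms cancel unless \<open>f u \<noteq> f v\<close>.
  \<close>
  define z where "z ys = (\<Sum>u\<in>U. \<Sum>v\<in>{v\<in>U. f v}. e (v # u # ys))" for ys
  have z_eq: "z ys = (of_bool (f v) - of_bool (f u)) * e (v # u # ys)"
    if ys: "distinct (v # u # ys)" "set (v # u # ys) = U" for u v ys
  proof -
    have uvU: "u \<in> U" "v \<in> U" "u \<noteq> v"
      using ys by auto
    have e_uv: "a = u \<and> b = v \<or> a = v \<and> b = u" if "e (b # a # ys) \<noteq> 0" for a b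
    proof -
      have "{a, b} = U - set ys" "{u, v} = U - set ys"
        using that ys e_0 by auto
      then show ?thesis
        by (metis doubleton_eq_iff)
    qed
    have "z ys = (\<Sum>(a, b)\<in>U \<times> {v\<in>U. f v}. e (b # a # ys))"
      by (simp add: z_def sum.cartesian_product)
    also have "\<dots> = (\<Sum>(a, b)\<in>(if f v then {(u, v)} else {}) \<union> (if f u then {(v, u)} else {}). e (b # a # ys))"
      using \<open>finite U\<close> uvU by (intro sum.mono_neutral_right) (auto dest: e_uv)
    also have "\<dots> = (of_bool (f v) - of_bool (f u)) * e (v # u # ys)"
      using \<open>u \<noteq> v\<close> e_swap[of "[]" u v ys] by auto
    finally show ?thesis .
  qed
  \<comment> \<open>The faces \<open>U - {u, v}\<close> have |U| - 2 vertices, hence dimension |U| -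
    3.\<close>
  define k where "k = int (card U) - 3"
  let ?Y = "induced_subcomplex Y U"
  have z_chain: "z \<in> simplicial_chains k ?Y"
    unfolding simplicial_chains_def
  proof (intro CollectI conjI allI impI)
    fix ys u v zs
    show "z (ys @ u # v # zs) = - z (ys @ v # u # zs)"
      unfolding z_def using e_swap[of "_ # _ # ys" u v zs] by (simp flip: sum_negf)
  next
    fix ys assume "z ys \<noteq> 0"
    then obtain u v where "e (v # u # ys) \<noteq> 0"
      unfolding z_def by (meson sum.not_neutral_contains_not_neutral)
    then have ys: "distinct (v # u # ys)" "set (v # u # ys) = U"
      using e_0 by blast+
    then have "f u \<noteq> f v"
      using z_eq \<open>z ys \<noteq> 0\<close> by fastforce
    moreover have uv: "set ys = U - {u, v}" "u \<in> U" "v \<in> U"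
      using ys by auto
    ultimately have "U - {u, v} \<in> Y"
      using f unfolding separating_colouring_def by blast
    then show "set ys \<in> ?Y"
      using uv by (simp add: induced_subcomplex_def)
    show "distinct ys"
      using ys by simp
    have "card U = length ys + 2"
      using ys distinct_card[of "v # u # ys"] by simp
    then show "int (length ys) = k + 1"
      by (simp add: k_def)
  qed
  have "simplicial_boundary z ys = 0" for ys
  proof -
    have "simplicial_boundary z ys = (\<Sum>x\<in>U. z (x # ys))"
    proof (rule simplicial_boundary_eq_sum[OF \<open>finite U\<close>])
      fix x assume "z (x # ys) \<noteq> 0"
      then show "x \<in> U"
        using z_chain by (auto simp: simplicial_chains_def induced_subcomplex_def)
    qed
    \<comment> \<open>The vertices \<open>u\<close> and \<open>x\<close> are those removed by the
      two boundary maps; for fixed \<open>v\<close> the summand alternates in them.\<close>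
    also have "\<dots> = (\<Sum>x\<in>U. \<Sum>v\<in>{v\<in>U. f v}. \<Sum>u\<in>U. e (v # u # x # ys))"
      unfolding z_def by (intro sum.cong refl sum.swap)
    also have "\<dots> = (\<Sum>v\<in>{v\<in>U. f v}. \<Sum>x\<in>U. \<Sum>u\<in>U. e (v # u # x # ys))"
      by (rule sum.swap)
    also have "\<dots> = 0"
    proof (rule sum.neutral, rule ballI)
      fix v
      show "(\<Sum>x\<in>U. \<Sum>u\<in>U. e (v # u # x # ys)) = 0"
      proof (rule sum_alternating_eq_0[OF \<open>finite U\<close>])
        show "e (v # x # x # ys) = 0" for x
          using e_0[of "v # x # x # ys"] by simp
        show "e (v # u # x # ys) = - e (v # x # u # ys)" for x u
          using e_swap[of "[v]" u x ys] by simp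
      qed
    qed
    finally show ?thesis .
  qed
  moreover have "int d \<le> k"
    using \<open>d + 3 \<le> card U\<close> by (simp add: k_def)
  ultimately obtain y where y: "y \<in> simplicial_chains (k + 1) ?Y" "z = simplicial_boundary y"
    using cycle_is_boundary[of k ?Y z] Y \<open>U \<subseteq> V\<close> z_chain unfolding leray_def by blast
  obtain u v where uv: "u \<in> U" "v \<in> U" "f u \<noteq> f v" "U - {u} \<notin> Y" "U - {v} \<notin> Y"
    using f by (auto simp: separating_colouring_def)
  obtain ys where ys: "set ys = U - {u, v}" "distinct ys"
    using finite_distinct_list[of "U - {u, v}"] \<open>finite U\<close> by auto
  \<comment> \<open>Adding one vertex of \<open>U\<close> to \<open>U - {u, v}\<close> gives
    \<open>U - {v}\<close> or \<open>U - {u}\<close>, and neither is a face.\<close>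
  have "y (x # ys) = 0" for x
  proof (rule ccontr)
    assume "y (x # ys) \<noteq> 0"
    then have "distinct (x # ys)" "set (x # ys) \<in> Y" "set (x # ys) \<subseteq> U"
      using y unfolding simplicial_chains_def induced_subcomplex_def by blast+
    then have "x \<in> U" "x \<notin> U - {u, v}"
      using ys by simp_all
    then have "x = u \<or> x = v"
      by blast
    moreover have "insert u (U - {u, v}) = U - {v}" "insert v (U - {u, v}) = U - {u}"
      using uv by auto
    ultimately have "set (x # ys) = U - {u} \<or> set (x # ys) = U - {v}"
      using ys by auto
    then show False
      using uv \<open>set (x # ys) \<in> Y\<close> by metis
  qed
  then have "z ys = 0"
    using y by (simp add: simplicial_boundary_def)
  moreover have "distinct (v # u # ys)" "set (v # u # ys) = U"
    using ys uv by auto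
  ultimately show False
    using z_eq[of v u ys] e_0[of "v # u # ys"] uv(3) by (simp add: of_bool_def split: if_splits)
qed

section \<open>Nerves of convex sets\<close>

text \<open>Helly's theorem relative to \<open>T\<close>. Choose \<open>x i\<close> in
  \<open>T\<close> and in all sets but \<open>A i\<close>. For each \<open>i\<close>, one part of a
  Radon partition of these points avoids \<open>x i\<close>, so its hull, and with it the Radon
  point, lies in \<open>A i\<close>.\<close>

lemma helly_aff_dim:
  fixes A :: "'i \<Rightarrow> 'a::euclidean_space set"
  assumes "finite I" and card: "aff_dim T + 2 \<le> int (card I)"
    and "convex T" and conv: "\<And>i. i \<in> I \<Longrightarrow> convex (A i)"
    and ne: "\<And>i. i \<in> I \<Longrightarrow> T \<inter> \<Inter>(A ` (I - {i})) \<noteq> {}"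
  shows "T \<inter> \<Inter>(A ` I) \<noteq> {}"
proof -
  have "\<forall>i\<in>I. \<exists>p. p \<in> T \<inter> \<Inter>(A ` (I - {i}))"
    using ne by blast
  then obtain x where x: "\<And>i. i \<in> I \<Longrightarrow> x i \<in> T \<inter> \<Inter>(A ` (I - {i}))"
    by metis
  have xA: "x i \<in> A j" if "i \<in> I" "j \<in> I" "i \<noteq> j" for i j
    using x[of i] that by auto
  show ?thesis
  proof (cases "inj_on x I")
    case True
    have sub: "x ` I \<subseteq> T"
      using x by blast
    have "aff_dim (x ` I) \<le> aff_dim T"
      by (rule aff_dim_subset[OF sub])
    then have "affine_dependent (x ` I)"
      using card card_image[OF True] affine_independent_iff_card[of "x ` I"] by auto
    then obtain M P where MP: "M \<inter> P = {}" "M \<union> P = x ` I"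
      and "convex hull M \<inter> convex hull P \<noteq> {}"
      using Radon_partition[of "x ` I"] \<open>finite I\<close> by auto
    then obtain y where y: "y \<in> convex hull M" "y \<in> convex hull P"
      by blast
    have hullA: "convex hull Q \<subseteq> A i" if "i \<in> I" "x i \<notin> Q" "Q \<subseteq> x ` I" for i Q
    proof (rule hull_minimal)
      show "Q \<subseteq> A i"
        using xA that by blast
    qed (use conv that in auto)
    have "y \<in> A i" if "i \<in> I" for i
      using hullA[OF that, of M] hullA[OF that, of P] MP y by blast
    moreover have "y \<in> T"
      using hull_minimal[of M T convex] \<open>convex T\<close> sub MP y by blast
    ultimately show ?thesis
      by auto
  next
    case False
    \<comment> \<open>Two coinciding witnesses have different exceptional indices, so their common
      value lies in every set.\<close>
    then obtain i j where ij: "i \<in> I" "j \<in> I" "i \<noteq> j" "x i = x j"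
      by (auto simp: inj_on_def)
    then have "x i \<in> A k" if "k \<in> I" for k
      using xA[of i k] xA[of j k] that by (cases "k = i") auto
    then show ?thesis
      using x[OF \<open>i \<in> I\<close>] by auto
  qed
qed

text \<open>The point \<open>p\<close> lies on the sphere around the ball containing
  \<open>Q\<close>, so a hyperplane separates it strictly from the hull of \<open>Q\<close>. Each
  segment from \<open>p\<close> to \<open>q\<close> crosses this hyperplane at parameter
  \<open>t q\<close>. The dimension drops because \<open>p\<close> is in \<open>T\<close> but not on
  the hyperplane.\<close>

lemma hyperplane_slice:
  fixes T :: "'a::euclidean_space set"
  assumes "finite Q" "convex T" "p \<in> T" "Q \<subseteq> T \<inter> ball 0 (norm p)"
  obtains T' t where "convex T'" "closed T'" "T' \<subseteq> T \<inter> ball 0 (norm p)" "aff_dim T' < aff_dim T"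
    and "\<And>q. q \<in> Q \<Longrightarrow> 0 < t q \<and> t q < (1::real) \<and> (1 - t q) *\<^sub>R p + t q *\<^sub>R q \<in> T'"
proof -
  let ?H = "convex hull Q"
  have "?H \<subseteq> ball 0 (norm p)"
    using assms by (intro hull_minimal) auto
  then have "p \<notin> ?H"
    by auto
  then obtain a b where ab: "a \<bullet> p < b" "\<And>x. x \<in> ?H \<Longrightarrow> b < a \<bullet> x"
    using separating_hyperplane_closed_point[of ?H p] finite_imp_compact_convex_hull[OF \<open>finite Q\<close>]
    by (auto simp: compact_imp_closed)
  define t where "t q = (b - a \<bullet> p) / (a \<bullet> q - a \<bullet> p)" for q
  define g where "g q = (1 - t q) *\<^sub>R p + t q *\<^sub>R q" for q
  have aq: "b < a \<bullet> q" if "q \<in> Q" for q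
    using ab(2) that by (simp add: hull_inc)
  have t: "0 < t q" "t q < 1" if "q \<in> Q" for q
    using ab(1) aq[OF that] by (auto simp: t_def field_simps)
  have gH: "a \<bullet> g q = b" if "q \<in> Q" for q
  proof -
    have "a \<bullet> g q = a \<bullet> p + t q * (a \<bullet> q - a \<bullet> p)"
      by (simp add: g_def algebra_simps)
    then show ?thesis
      using ab(1) aq[OF that] by (simp add: t_def)
  qed
  have gT: "g q \<in> T" if "q \<in> Q" for q
    unfolding g_def using that assms t[OF that] by (intro convexD) auto
  have gb: "norm (g q) < norm p" if "q \<in> Q" for q
  proof -
    have "norm (g q) \<le> (1 - t q) * norm p + t q * norm q"
      unfolding g_def using t[OF that] by (intro norm_triangle_le) auto
    also have "\<dots> < (1 - t q) * norm p + t q * norm p"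
      using t[OF that] assms(4) that by auto
    finally show ?thesis
      by (simp add: algebra_simps)
  qed
  \<comment> \<open>The hull of the finitely many crossing points is compact; the section of the
    open ball need not be closed.\<close>
  define T' where "T' = convex hull (g ` Q)"
  have T'_sub: "T' \<subseteq> T \<inter> ball 0 (norm p) \<inter> {x. a \<bullet> x = b}"
    unfolding T'_def using gT gH gb \<open>convex T\<close>
    by (intro hull_minimal convex_Int) (auto simp: convex_hyperplane)
  have "affine hull T' \<subseteq> {x. a \<bullet> x = b}"
    using T'_sub by (intro hull_minimal) (auto simp: affine_hyperplane)
  moreover have "affine hull T' \<subseteq> affine hull T"
    using T'_sub by (intro hull_mono) auto
  moreover have "p \<in> affine hull T"
    using \<open>p \<in> T\<close> by (simp add: hull_inc)
  ultimately have "aff_dim T' < aff_dim T"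
    using ab(1) by (intro aff_dim_psubset) auto
  moreover have "closed T'" "convex T'"
    using \<open>finite Q\<close> finite_imp_compact_convex_hull[of "g ` Q"]
    by (auto simp: T'_def compact_imp_closed)
  moreover have "g q \<in> T'" if "q \<in> Q" for q
    using that by (auto simp: T'_def hull_inc)
  ultimately show thesis
    using that[of T' t] T'_sub t unfolding g_def by blast
qed

section \<open>Separating colourings and families of convex sets\<close>

text \<open>The set \<open>T\<close> carries the induction: passing to a slice lowers its dimension
  while the sets \<open>A i\<close> stay the same and one index is dropped.\<close>

lemma no_separating_colouring_convex:
  fixes A :: "'i \<Rightarrow> 'a::euclidean_space set"
  assumes "finite U" "\<And>i. i \<in> U \<Longrightarrow> convex (A i)" "\<And>i. i \<in> U \<Longrightarrow> closed (A i)"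
    and "convex T" "closed T" "aff_dim T < int n" "n + 2 \<le> card U"
  shows "\<not> separating_colouring {\<sigma>. T \<inter> \<Inter>(A ` \<sigma>) \<noteq> {}} U f"
  using assms
proof (induction n arbitrary: T U f)
  case 0
  \<comment> \<open>Then every cell is empty, whereas two vertices of different colours require a
    nonempty one.\<close>
  then have "T = {}"
    by simp
  then show ?case
    by (auto simp: separating_colouring_def)
next
  case (Suc k)
  note fin = Suc.prems(1) and convA = Suc.prems(2) and closedA = Suc.prems(3)
    and T = Suc.prems(4,5) and dimT = Suc.prems(6) and cardU = Suc.prems(7)
  define cell where "cell \<sigma> = T \<inter> \<Inter>(A ` \<sigma>)" for \<sigma>
  define near where "near \<sigma> = closest_point (cell \<sigma>) 0" for \<sigma>
  txt \<open>
    Among the separating colourings take one whose largest distance \<open>r\<close> from the origin to a cell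
    \<open>U - {x, y}\<close>, with \<open>x\<close> and \<open>y\<close> of different colours, is least and attained by the fewest pairs.
    Let \<open>p\<close> be the nearest point of such a cell \<open>U - {u, v}\<close> at distance \<open>r\<close>. If \<open>p\<close> lies in neither
    \<open>A u\<close> nor \<open>A v\<close>, then Helly's theorem, with the ball of radius \<open>r\<close> in the place of \<open>A u\<close>, yields a
    nearer point of the cell.
  \<close>
  define w where "w x y = norm (near (U - {x, y}))" for x y
  define valid where "valid = separating_colouring {\<sigma>. cell \<sigma> \<noteq> {}} U"
  have w_sym: "w x y = w y x" for x y
    by (simp add: w_def insert_commute)
  have cell_cc: "closed (cell \<sigma>)" "convex (cell \<sigma>)" if "\<sigma> \<subseteq> U" for \<sigma>
    unfolding cell_def using that T convA closedA
    by (auto intro!: closed_INT convex_Int convex_INT)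
  have cell_mono: "cell \<sigma> \<subseteq> cell \<rho>" if "\<rho> \<subseteq> \<sigma>" for \<sigma> \<rho>
    using that by (auto simp: cell_def)
  have near_in: "near \<sigma> \<in> cell \<sigma>" if "\<sigma> \<subseteq> U" "cell \<sigma> \<noteq> {}" for \<sigma>
    unfolding near_def using cell_cc that by (intro closest_point_in_set) auto
  have near_le: "norm (near \<sigma>) \<le> norm x" if "\<sigma> \<subseteq> U" "x \<in> cell \<sigma>" for \<sigma> x
    using closest_point_le[of "cell \<sigma>" x 0] cell_cc that by (simp add: near_def)
  \<comment> \<open>A cell missing the open ball has at most one point of norm at most
    \<open>r\<close>, by uniqueness of the nearest point.\<close>
  have near_unique: "x = y"
    if "\<sigma> \<subseteq> U" "x \<in> cell \<sigma>" "y \<in> cell \<sigma>" "norm x \<le> r" "norm y \<le> r" "cell \<sigma> \<inter> ball 0 r = {}" for \<sigma> x y r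
  proof -
    have "r \<le> norm z" if "z \<in> cell \<sigma>" for z
      using that \<open>cell \<sigma> \<inter> ball 0 r = {}\<close> by (force simp: disjoint_iff)
    then have "\<forall>z\<in>cell \<sigma>. dist 0 x \<le> dist 0 z" "\<forall>z\<in>cell \<sigma>. dist 0 y \<le> dist 0 z"
      using that by force+
    then show ?thesis
      using closest_point_unique cell_cc that by metis
  qed
  show ?case
  proof
    assume "separating_colouring {\<sigma>. T \<inter> \<Inter>(A ` \<sigma>) \<noteq> {}} U f"
    then have "valid f"
      by (simp add: valid_def cell_def)
    \<comment> \<open>Colourings are functions on the whole type and may be infinitely many, but
      \<open>w\<close> takes finitely many values on \<open>U\<close>, so a least bound
      exists.\<close>
    define R where "R = (\<lambda>(x, y). w x y) ` (U \<times> U)"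
    define good where "good r g \<longleftrightarrow> valid g \<and> (\<forall>x\<in>U. \<forall>y\<in>U. g x \<noteq> g y \<longrightarrow> w x y \<le> r)" for r g
    have "finite R"
      using fin by (simp add: R_def)
    have attained: "\<exists>r\<in>R. good r g \<and> (\<exists>x\<in>U. \<exists>y\<in>U. g x \<noteq> g y \<and> w x y = r)" if g: "valid g" for g
    proof -
      let ?E = "{(x, y) \<in> U \<times> U. g x \<noteq> g y}"
      let ?W = "(\<lambda>(x, y). w x y) ` ?E"
      have "finite ?E"
        using fin by (auto intro: finite_subset[of _ "U \<times> U"])
      moreover obtain a b where "a \<in> U" "b \<in> U" "g a \<noteq> g b"
        using g unfolding valid_def separating_colouring_def by blast
      then have "(a, b) \<in> ?E"
        by simp
      ultimately have "finite ?W" "?W \<noteq> {}"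
        by blast+
      then have "Max ?W \<in> ?W" "\<forall>s\<in>?W. s \<le> Max ?W"
        by auto
      then show ?thesis
        using g unfolding good_def R_def by (intro bexI[of _ "Max ?W"]) force+
    qed
    let ?R = "{r \<in> R. \<exists>g. good r g}"
    have "finite ?R" "?R \<noteq> {}"
      using \<open>finite R\<close> attained[OF \<open>valid f\<close>] by auto
    define r where "r = Min ?R"
    have "r \<in> ?R"
      unfolding r_def using \<open>finite ?R\<close> \<open>?R \<noteq> {}\<close> by (rule Min_in)
    define tight where "tight g = {(x, y) \<in> U \<times> U. g x \<noteq> g y \<and> w x y = r}" for g :: "'i \<Rightarrow> bool"
    obtain f where f: "good r f" and f_min: "\<And>g. good r g \<Longrightarrow> card (tight f) \<le> card (tight g)"
      using \<open>r \<in> ?R\<close> ex_has_least_nat[of "good r" _ "\<lambda>g. card (tight g)"] by blast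
    have cross: "cell (U - {x, y}) \<noteq> {}" "w x y \<le> r" if "x \<in> U" "y \<in> U" "f x \<noteq> f y" for x y
      using f that by (auto simp: good_def valid_def separating_colouring_def)
    have near_cross: "near (U - {x, y}) \<in> cell (U - {x, y})" if "x \<in> U" "y \<in> U" "f x \<noteq> f y" for x y
      using near_in[of "U - {x, y}"] cross(1)[OF that] by auto
    obtain u0 v0 where u0v0: "u0 \<in> U" "v0 \<in> U" "f u0 \<noteq> f v0"
      and empty0: "cell (U - {u0}) = {}" "cell (U - {v0}) = {}"
      using f by (auto simp: good_def valid_def separating_colouring_def)
    have "cell U = {}"
      using cell_mono[of "U - {u0}" U] empty0 by blast
    have in_two: False if "x \<in> U" "z \<in> cell (U - {x})" "z \<in> A x" for x z
    proof -
      have "z \<in> cell U"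
        using that unfolding cell_def by blast
      then show False
        using \<open>cell U = {}\<close> by simp
    qed
    \<comment> \<open>As \<open>x\<close> and \<open>u\<close> differ in colour, the cell of
      \<open>U - {x, u}\<close> has a point of norm at most \<open>r\<close>. It also lies in the
      cell of \<open>U - {x, u, v}\<close>, hence equals \<open>p\<close>; and \<open>v\<close> is
      among the indices of the smaller cell.\<close>
    have swap: "p \<in> A v" if "u \<in> U" "u \<noteq> v" "v \<in> U"
      and "cell (U - {x, u, v}) \<inter> ball 0 r = {}" "p \<in> cell (U - {x, u, v})" "norm p \<le> r"
        "x \<in> U" "f x \<noteq> f u" "x \<noteq> v" for u v x p
    proof -
      have "near (U - {x, u}) \<in> cell (U - {x, u})"
        using near_cross that by simp
      moreover have "norm (near (U - {x, u})) \<le> r"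
        using cross[of x u] that by (simp add: w_def)
      moreover have "cell (U - {x, u}) \<subseteq> cell (U - {x, u, v})"
        by (rule cell_mono) blast
      ultimately have "near (U - {x, u}) = p"
        using that by (intro near_unique[of "U - {x, u, v}" _ _ r]) auto
      then show ?thesis
        using \<open>near (U - {x, u}) \<in> cell (U - {x, u})\<close> that by (auto simp: cell_def)
    qed
    txt \<open>
      If \<open>p\<close> lies in \<open>A u\<close>, the cell of \<open>U - {v}\<close> is not empty and \<open>v\<close> may change its colour. Either
      this improves the colouring, or some \<open>y\<close> of the colour of \<open>v\<close> obstructs it; then the cells,
      cut with the ball, move to a hyperplane separating them from \<open>p\<close>, where \<open>f\<close> separates \<open>U - {v}\<close>.
    \<close>
    have no_u: False
      if uv: "u \<in> U" "v \<in> U" "f u \<noteq> f v" "w u v = r" and pu: "near (U - {u, v}) \<in> A u" for u v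
    proof -
      define p where "p = near (U - {u, v})"
      have "p \<in> cell (U - {u, v})"
        unfolding p_def using near_cross uv by simp
      then have pv: "p \<in> cell (U - {v})"
        using pu by (auto simp: cell_def p_def)
      have pr: "norm p = r"
        using uv by (simp add: p_def w_def)
      have disj: "cell (U - {u, v}) \<inter> ball 0 r = {}"
        using near_le[of "U - {u, v}"] pr by (force simp: disjoint_iff p_def)
      show False
      proof (cases "\<exists>y\<in>U - {v}. f y = f v \<and> cell (U - {y, v}) \<inter> ball 0 r = {}")
        case True
        then obtain y where y: "y \<in> U" "y \<noteq> v" "f y = f v" "cell (U - {y, v}) \<inter> ball 0 r = {}"
          by blast
        \<comment> \<open>Otherwise \<open>swap\<close> puts \<open>p\<close> into
          \<open>A v\<close>, hence into the empty cell of \<open>U\<close>.\<close>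
        have ex: "cell (U - {a, b, v}) \<inter> ball 0 r \<noteq> {}"
          if "a \<in> U - {v}" "b \<in> U - {v}" "f a \<noteq> f b" for a b
        proof
          assume "cell (U - {a, b, v}) \<inter> ball 0 r = {}"
          moreover have "p \<in> cell (U - {a, b, v})"
            using pv cell_mono[of "U - {a, b, v}" "U - {v}"] by blast
          ultimately have "p \<in> A v"
            using swap[of b v a p] that uv pr by auto
          then show False
            using in_two pv uv by blast
        qed
        define E where "E = {(a, b) \<in> (U - {v}) \<times> (U - {v}). f a \<noteq> f b}"
        have "\<forall>e\<in>E. \<exists>q. q \<in> cell (U - {fst e, snd e, v}) \<inter> ball 0 r"
          using ex unfolding E_def by fastforce
        then obtain q where q: "\<And>e. e \<in> E \<Longrightarrow> q e \<in> cell (U - {fst e, snd e, v}) \<inter> ball 0 r"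
          by metis
        have "finite E"
          using fin by (auto simp: E_def intro: finite_subset[of _ "U \<times> U"])
        moreover have "p \<in> T" "q ` E \<subseteq> T \<inter> ball 0 (norm p)"
          using pv q pr by (auto simp: cell_def)
        ultimately obtain T' t where T': "convex T'" "closed T'" "T' \<subseteq> T \<inter> ball 0 (norm p)"
            "aff_dim T' < aff_dim T"
          and t: "\<And>x. x \<in> q ` E \<Longrightarrow> 0 < t x \<and> t x < (1::real) \<and> (1 - t x) *\<^sub>R p + t x *\<^sub>R x \<in> T'"
          using hyperplane_slice[of "q ` E" T p] T by blast
        \<comment> \<open>The point of \<open>T'\<close> lies on the segment from \<open>p\<close>
          to \<open>q (a, b)\<close>, whose ends are both in each remaining
          \<open>A i\<close>.\<close>
        have faces: "T' \<inter> \<Inter>(A ` (U - {v} - {a, b})) \<noteq> {}" if "(a, b) \<in> E" for a b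
        proof -
          let ?z = "(1 - t (q (a, b))) *\<^sub>R p + t (q (a, b)) *\<^sub>R q (a, b)"
          have tq: "0 < t (q (a, b))" "t (q (a, b)) < 1" "?z \<in> T'"
            using t that by blast+
          have "?z \<in> A i" if i: "i \<in> U - {v} - {a, b}" for i
          proof (rule convexD)
            show "convex (A i)"
              using convA i by simp
            show "p \<in> A i"
              using pv i by (auto simp: cell_def)
            show "q (a, b) \<in> A i"
              using q[OF \<open>(a, b) \<in> E\<close>] i by (auto simp: cell_def)
          qed (use tq in auto)
          then show ?thesis
            using tq by blast
        qed
        have nonfaces: "T' \<inter> \<Inter>(A ` (U - {v} - {x})) = {}" if "cell (U - {x, v}) \<inter> ball 0 r = {}" for x
        proof -
          have "T' \<inter> \<Inter>(A ` (U - {v} - {x})) \<subseteq> cell (U - {x, v}) \<inter> ball 0 r"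
            using T' pr by (auto simp: cell_def)
          then show ?thesis
            using that by blast
        qed
        \<comment> \<open>The required nonfaces come from \<open>u\<close> and \<open>y\<close>,
          which differ in colour since \<open>f y = f v\<close>.\<close>
        have "separating_colouring {\<sigma>. T' \<inter> \<Inter>(A ` \<sigma>) \<noteq> {}} (U - {v}) f"
          unfolding separating_colouring_def
        proof (intro conjI ballI impI bexI)
          show "U - {v} - {u} \<notin> {\<sigma>. T' \<inter> \<Inter>(A ` \<sigma>) \<noteq> {}}"
            using nonfaces[OF disj] by blast
          show "U - {v} - {y} \<notin> {\<sigma>. T' \<inter> \<Inter>(A ` \<sigma>) \<noteq> {}}"
            using nonfaces[OF y(4)] by blast
          show "U - {v} - {a, b} \<in> {\<sigma>. T' \<inter> \<Inter>(A ` \<sigma>) \<noteq> {}}"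
            if "a \<in> U - {v}" "b \<in> U - {v}" "f a \<noteq> f b" for a b
            using faces[of a b] that unfolding E_def by simp
        qed (use uv y in auto)
        moreover have "aff_dim T' < int k" "k + 2 \<le> card (U - {v})"
          using T' dimT cardU uv fin by auto
        ultimately show False
          using Suc.IH[of "U - {v}" T' f] fin convA closedA T' by auto
      next
        case False
        then have loose: "cell (U - {y, v}) \<inter> ball 0 r \<noteq> {}" if "y \<in> U" "y \<noteq> v" "f y = f v" for y
          using that by blast
        have w_less: "w v y < r" "w y v < r" if yU: "y \<in> U" "y \<noteq> v" "f y = f v" for y
        proof -
          obtain z where "z \<in> cell (U - {y, v})" "norm z < r"
            using loose[OF yU] by auto
          then show "w v y < r" "w y v < r"
            using near_le[of "U - {y, v}" z] w_sym[of v y] by (auto simp: w_def)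
        qed
        \<comment> \<open>The flip makes only pairs of weight below \<open>r\<close> bichromatic,
          and \<open>(u, v)\<close> stops being so: the tight pairs become strictly fewer.\<close>
        define g where "g = f(v := \<not> f v)"
        have "good r g"
          unfolding good_def
        proof
          have ne: "cell (U - {x, y}) \<noteq> {}" if "x = v \<or> y = v" for x y
            using pv cell_mono[of "U - {x, y}" "U - {v}"] that by blast
          have "u0 \<noteq> v" "v0 \<noteq> v"
            using empty0 pv by auto
          then show "valid g"
            unfolding valid_def separating_colouring_def
          proof (intro conjI ballI impI)
            show "U - {x, y} \<in> {\<sigma>. cell \<sigma> \<noteq> {}}" if "x \<in> U" "y \<in> U" "g x \<noteq> g y" for x y
              using ne[of x y] cross(1)[of x y] that by (cases "x = v \<or> y = v") (auto simp: g_def)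
            have "g u0 \<noteq> g v0"
              using u0v0 \<open>u0 \<noteq> v\<close> \<open>v0 \<noteq> v\<close> by (simp add: g_def)
            then show "\<exists>x\<in>U. \<exists>y\<in>U. g x \<noteq> g y \<and> U - {x} \<notin> {\<sigma>. cell \<sigma> \<noteq> {}} \<and> U - {y} \<notin> {\<sigma>. cell \<sigma> \<noteq> {}}"
              using u0v0 empty0 by blast
          qed
          show "\<forall>x\<in>U. \<forall>y\<in>U. g x \<noteq> g y \<longrightarrow> w x y \<le> r"
            using w_less cross(2) by (auto simp: g_def intro: less_imp_le)
        qed
        moreover have "tight g \<subset> tight f"
        proof
          show "tight g \<subseteq> tight f"
            using w_less by (auto simp: tight_def g_def split: if_splits)
          have "(u, v) \<in> tight f" "(u, v) \<notin> tight g"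
            using uv by (auto simp: tight_def g_def)
          then show "tight g \<noteq> tight f"
            by blast
        qed
        moreover have "finite (tight f)"
          using fin by (auto simp: tight_def intro: finite_subset[of _ "U \<times> U"])
        ultimately show False
          using f_min psubset_card_mono by (metis leD)
      qed
    qed
    \<comment> \<open>The largest weight of \<open>f\<close> is at most \<open>r\<close>, and it is
      not smaller because \<open>r\<close> is the least bound over all valid colourings.\<close>
    obtain u v where uv: "u \<in> U" "v \<in> U" "f u \<noteq> f v" "w u v = r"
    proof -
      obtain r' x y where r': "r' \<in> R" "good r' f" "x \<in> U" "y \<in> U" "f x \<noteq> f y" "w x y = r'"
        using attained f unfolding good_def by blast
      then have "r \<le> r'"
        unfolding r_def using \<open>finite ?R\<close> by (intro Min_le) auto
      moreover have "r' \<le> r"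
        using cross r' by blast
      ultimately show thesis
        using that r' by auto
    qed
    define p where "p = near (U - {u, v})"
    have pc: "p \<in> cell (U - {u, v})"
      unfolding p_def using near_cross uv by simp
    have pr: "norm p = r"
      using uv by (simp add: p_def w_def)
    have disj: "cell (U - {u, v}) \<inter> ball 0 r = {}"
      using near_le[of "U - {u, v}"] pr by (force simp: disjoint_iff p_def)
    have pnot: "p \<notin> A u" "p \<notin> A v"
      using no_u[of u v] no_u[of v u] uv w_sym by (auto simp: p_def insert_commute)
    define B where "B = A(u := ball 0 r)"
    \<comment> \<open>Helly applies since \<open>T\<close> has dimension at most \<open>k\<close>
      and \<open>U - {v}\<close> has at least \<open>k + 2\<close> elements.\<close>
    have "T \<inter> \<Inter>(B ` (U - {v})) \<noteq> {}"
    proof (rule helly_aff_dim)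
      fix i assume i: "i \<in> U - {v}"
      show "convex (B i)"
        using convA i by (auto simp: B_def)
      show "T \<inter> \<Inter>(B ` (U - {v} - {i})) \<noteq> {}"
      proof (cases "i = u")
        case True
        then have "p \<in> T \<inter> \<Inter>(B ` (U - {v} - {i}))"
          using pc by (auto simp: B_def cell_def)
        then show ?thesis
          by blast
      next
        case False
        \<comment> \<open>The colour of \<open>i\<close> differs from that of \<open>u\<close> or of
          \<open>v\<close>; if the cut cell were empty, \<open>swap\<close> would put
          \<open>p\<close> into \<open>A v\<close> or \<open>A u\<close> respectively.\<close>
        have "cell (U - {i, u, v}) \<inter> ball 0 r \<noteq> {}"
        proof
          assume e: "cell (U - {i, u, v}) \<inter> ball 0 r = {}"
          have "p \<in> cell (U - {i, u, v})"
            using pc cell_mono[of "U - {i, u, v}" "U - {u, v}"] by blast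
          then have "p \<in> A u \<or> p \<in> A v"
            using swap[of u v i p] swap[of v u i p] e uv i False pr
            by (cases "f i = f u") (auto simp: insert_commute)
          then show False
            using pnot by blast
        qed
        then obtain z where "z \<in> cell (U - {i, u, v})" "z \<in> ball 0 r"
          by blast
        then have "z \<in> T \<inter> \<Inter>(B ` (U - {v} - {i}))"
          by (auto simp: B_def cell_def)
        then show ?thesis
          by blast
      qed
    qed (use fin T dimT cardU uv in auto)
    moreover have "T \<inter> \<Inter>(B ` (U - {v})) \<subseteq> cell (U - {u, v}) \<inter> ball 0 r"
    proof
      fix z assume "z \<in> T \<inter> \<Inter>(B ` (U - {v}))"
      then have zB: "z \<in> B i" if "i \<in> U - {v}" for i
        using that by blast
      have "u \<in> U - {v}"
        using uv by auto
      then have "z \<in> T" "z \<in> ball 0 r"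
        using zB[of u] \<open>z \<in> T \<inter> \<Inter>(B ` (U - {v}))\<close> by (simp_all add: B_def)
      moreover have "z \<in> A i" if "i \<in> U - {u, v}" for i
        using zB[of i] that by (simp add: B_def)
      ultimately show "z \<in> cell (U - {u, v}) \<inter> ball 0 r"
        by (simp add: cell_def)
    qed
    ultimately show False
      using disj by blast
  qed
qed

lemma representable_no_separating_colouring:
  assumes Y: "representable TYPE('d::finite) V Y" and "U \<subseteq> V" and card: "CARD('d) + 3 \<le> card U"
  shows "\<not> separating_colouring Y U f"
proof -
  obtain m g and F :: "nat \<Rightarrow> (real ^ 'd) set"
    where F: "\<forall>i\<in>{1..m}. compact (F i) \<and> convex (F i)"
      and g: "bij_betw g V {1..m}" and nerve: "\<forall>\<sigma>. \<sigma> \<subseteq> V \<longrightarrow> (\<sigma> \<in> Y \<longleftrightarrow> g ` \<sigma> \<in> nerve {1..m} F)"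
    using Y by (auto simp: representable_def isomorphic_complexes_def)
  have gU: "g v \<in> {1..m}" if "v \<in> U" for v
    using bij_betwE[OF g] \<open>U \<subseteq> V\<close> that by blast
  have "\<not> separating_colouring {\<sigma>. UNIV \<inter> \<Inter>((\<lambda>v. F (g v)) ` \<sigma>) \<noteq> {}} U f"
  proof (rule no_separating_colouring_convex)
    show "finite U"
      using card by (intro card_ge_0_finite) simp
    show "convex (F (g v))" "closed (F (g v))" if "v \<in> U" for v
      using F gU[OF that] by (blast intro: compact_imp_closed)+
    \<comment> \<open>The bound on the dimension is strict, so \<open>n\<close> is
      \<open>CARD('d) + 1\<close> and \<open>n + 2\<close> becomes
      \<open>CARD('d) + 3\<close>.\<close>
    show "aff_dim (UNIV :: (real ^ 'd) set) < int (CARD('d) + 1)"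
      by simp
    show "CARD('d) + 1 + 2 \<le> card U"
      using card by simp
  qed auto
  moreover have "\<sigma> \<in> Y \<longleftrightarrow> \<sigma> \<in> {\<sigma>. UNIV \<inter> \<Inter>((\<lambda>v. F (g v)) ` \<sigma>) \<noteq> {}}" if "\<sigma> \<subseteq> U" for \<sigma>
  proof -
    have "g ` \<sigma> \<subseteq> {1..m}"
      using gU that by blast
    then show ?thesis
      using nerve that \<open>U \<subseteq> V\<close> by (simp add: nerve_def image_image)
  qed
  ultimately show ?thesis
    using separating_colouring_cong by blast
qed

section \<open>Missing faces of Steiner type\<close>

lemma nonface_contains_missing_face:
  assumes "finite \<sigma>" "\<sigma> \<subseteq> V" "\<sigma> \<notin> X"
  shows "\<exists>\<tau>\<in>missing_faces V X. \<tau> \<subseteq> \<sigma>"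
  using assms
proof (induction \<sigma> rule: finite_psubset_induct)
  case (psubset \<sigma>)
  show ?case
  proof (cases "\<sigma> \<in> missing_faces V X")
    case False
    then obtain \<rho> where "\<rho> \<subset> \<sigma>" "\<rho> \<notin> X"
      using psubset.prems by (auto simp: missing_faces_def)
    then show ?thesis
      using psubset.IH[of \<rho>] psubset.prems by blast
  qed auto
qed

lemma missing_face_subset: "\<tau> \<in> missing_faces V X \<Longrightarrow> \<tau> \<subseteq> V"
  by (simp add: missing_faces_def)

lemma missing_face_not_face: "\<tau> \<in> missing_faces V X \<Longrightarrow> \<tau> \<notin> X"
  by (simp add: missing_faces_def)

text \<open>For \<open>u\<close> in \<open>\<alpha>\<close> and \<open>v\<close> outside, a missing
  face inside the union without \<open>u\<close> and \<open>v\<close> would differ from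
  \<open>\<alpha>\<close> and have a smaller union with it. The nonfaces arise by deleting a vertex
  of only one of \<open>\<alpha>\<close>, \<open>\<beta>\<close>, which leaves the other
  intact.\<close>

lemma separating_colouring_from_missing_faces:
  assumes "finite V" and down: "\<And>\<sigma> \<tau>. \<sigma> \<in> Y \<Longrightarrow> \<tau> \<subseteq> \<sigma> \<Longrightarrow> \<tau> \<in> Y"
    and \<alpha>: "\<alpha> \<in> missing_faces V Y" and \<beta>: "\<beta> \<in> missing_faces V Y" and "\<alpha> \<noteq> \<beta>"
    and min: "\<And>\<rho>. \<rho> \<in> missing_faces V Y \<Longrightarrow> \<rho> \<noteq> \<alpha> \<Longrightarrow> card (\<alpha> \<union> \<beta>) \<le> card (\<alpha> \<union> \<rho>)"
  shows "separating_colouring Y (\<alpha> \<union> \<beta>) (\<lambda>v. v \<in> \<alpha>)"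
proof -
  let ?U = "\<alpha> \<union> \<beta>"
  have "?U \<subseteq> V"
    using \<alpha> \<beta> missing_face_subset by blast
  then have "finite ?U"
    using \<open>finite V\<close> finite_subset by blast
  have face: "?U - {u, v} \<in> Y" if "u \<in> \<alpha>" "v \<in> ?U - \<alpha>" for u v
  proof (rule ccontr)
    assume "?U - {u, v} \<notin> Y"
    then obtain \<rho> where \<rho>: "\<rho> \<in> missing_faces V Y" "\<rho> \<subseteq> ?U - {u, v}"
      using nonface_contains_missing_face[of "?U - {u, v}" V Y] \<open>?U \<subseteq> V\<close> \<open>finite ?U\<close> by blast
    then have "\<rho> \<noteq> \<alpha>" "\<alpha> \<union> \<rho> \<subset> ?U"
      using that by blast+
    then show False
      using min[OF \<rho>(1)] psubset_card_mono[OF \<open>finite ?U\<close>] by (metis leD)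
  qed
  have "\<not> \<alpha> \<subseteq> \<beta>" "\<not> \<beta> \<subseteq> \<alpha>"
    using \<alpha> \<beta> \<open>\<alpha> \<noteq> \<beta>\<close> by (auto simp: missing_faces_def)
  then obtain u v where uv: "u \<in> \<alpha> - \<beta>" "v \<in> \<beta> - \<alpha>"
    by blast
  then have "\<beta> \<subseteq> ?U - {u}" "\<alpha> \<subseteq> ?U - {v}"
    by blast+
  then have "?U - {u} \<notin> Y" "?U - {v} \<notin> Y"
    using down missing_face_not_face \<alpha> \<beta> by metis+
  moreover have "?U - {x, y} \<in> Y" if "x \<in> ?U" "y \<in> ?U" "(x \<in> \<alpha>) \<noteq> (y \<in> \<alpha>)" for x y
    using face[of x y] face[of y x] that by (auto simp: insert_commute)
  ultimately show ?thesis
    unfolding separating_colouring_def using uv by blast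
qed

text \<open>Two omitted sets would be missing faces of \<open>Y\<close>, as their proper subsets lie
  in \<open>X\<close>. Any missing face of \<open>Y\<close> contains one of \<open>X\<close>, so it
  has at least \<open>d + 1\<close> elements, with equality only if it is one of
  \<open>X\<close>.\<close>

lemma steiner_missing_face_unique:
  assumes X: "abstract_simplicial_complex V X" "partial_steiner_system d n V (missing_faces V X)"
    and Y: "abstract_simplicial_complex V Y" "X \<subseteq> Y"
    and no_sep: "\<And>U f. U \<subseteq> V \<Longrightarrow> d + 3 \<le> card U \<Longrightarrow> \<not> separating_colouring Y U f"
    and \<tau>: "\<tau> \<in> missing_faces V X" "\<tau> \<notin> Y" and \<tau>': "\<tau>' \<in> missing_faces V X" "\<tau>' \<notin> Y"
  shows "\<tau> = \<tau>'"
proof (rule ccontr)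
  assume "\<tau> \<noteq> \<tau>'"
  let ?N = "missing_faces V Y"
  have "finite V" and down: "\<And>\<sigma> \<tau>. \<sigma> \<in> Y \<Longrightarrow> \<tau> \<subseteq> \<sigma> \<Longrightarrow> \<tau> \<in> Y"
    using Y by (auto simp: abstract_simplicial_complex_def)
  have size: "d + 1 \<le> card \<rho> \<and> (card \<rho> = d + 1 \<longrightarrow> \<rho> \<in> missing_faces V X)" if "\<rho> \<in> ?N" for \<rho>
  proof -
    have \<rho>: "\<rho> \<subseteq> V" "\<rho> \<notin> X" "finite \<rho>"
      using that Y(2) missing_face_subset[OF that] missing_face_not_face[OF that]
        finite_subset[OF _ \<open>finite V\<close>] by blast+
    then obtain \<tau> where \<tau>: "\<tau> \<in> missing_faces V X" "\<tau> \<subseteq> \<rho>"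
      using nonface_contains_missing_face by metis
    then have "card \<tau> = d + 1"
      using X(2) unfolding partial_steiner_system_def by blast
    then show ?thesis
      using \<tau> card_mono[OF \<open>finite \<rho>\<close> \<tau>(2)] card_subset_eq[OF \<open>finite \<rho>\<close> \<tau>(2)] by auto
  qed
  have "\<tau> \<in> ?N" "\<tau>' \<in> ?N"
    using \<tau> \<tau>' Y(2) unfolding missing_faces_def by blast+
  let ?P = "\<lambda>e. fst e \<in> ?N \<and> snd e \<in> ?N \<and> fst e \<noteq> snd e"
  have "?P (\<tau>, \<tau>')"
    using \<open>\<tau> \<in> ?N\<close> \<open>\<tau>' \<in> ?N\<close> \<open>\<tau> \<noteq> \<tau>'\<close> by simp
  from ex_has_least_nat[of ?P, OF this, of "\<lambda>e. card (fst e \<union> snd e)"]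
  obtain e where e: "?P e"
    and e_min: "\<forall>e'. ?P e' \<longrightarrow> card (fst e \<union> snd e) \<le> card (fst e' \<union> snd e')"
    by blast
  obtain \<alpha> \<beta> where e_eq: "e = (\<alpha>, \<beta>)"
    by (cases e)
  have \<alpha>\<beta>: "\<alpha> \<in> ?N" "\<beta> \<in> ?N" "\<alpha> \<noteq> \<beta>"
    using e by (auto simp: e_eq)
  have sub: "\<alpha> \<subseteq> V" "\<beta> \<subseteq> V" "finite \<alpha>" "finite \<beta>"
    using \<alpha>\<beta> missing_face_subset finite_subset[OF _ \<open>finite V\<close>] by metis+
  have "separating_colouring Y (\<alpha> \<union> \<beta>) (\<lambda>v. v \<in> \<alpha>)"
  proof (rule separating_colouring_from_missing_faces[OF \<open>finite V\<close> down \<alpha>\<beta>])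
    show "card (\<alpha> \<union> \<beta>) \<le> card (\<alpha> \<union> \<rho>)" if "\<rho> \<in> ?N" "\<rho> \<noteq> \<alpha>" for \<rho>
      using e_min[rule_format, of "(\<alpha>, \<rho>)"] \<alpha>\<beta> that by (simp add: e_eq)
  qed
  moreover have "d + 3 \<le> card (\<alpha> \<union> \<beta>)"
  proof (cases "card \<alpha> = d + 1 \<and> card \<beta> = d + 1")
    case True
    then have M: "\<alpha> \<in> missing_faces V X" "\<beta> \<in> missing_faces V X"
      using size \<alpha>\<beta> by auto
    have "card (\<alpha> \<inter> \<beta>) < d"
    proof (rule ccontr)
      assume "\<not> card (\<alpha> \<inter> \<beta>) < d"
      then have "d \<le> card (\<alpha> \<inter> \<beta>)"
        by simp
      then obtain \<sigma> where \<sigma>: "\<sigma> \<subseteq> \<alpha> \<inter> \<beta>" "card \<sigma> = d"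
        by (rule obtain_subset_with_card_n)
      then have "\<sigma> \<subseteq> V \<and> card \<sigma> = d" "\<sigma> \<subseteq> \<alpha> \<and> \<sigma> \<subseteq> \<beta>"
        using sub(1) by auto
      then have "\<alpha> = \<beta>"
        using X(2) M unfolding partial_steiner_system_def by blast
      then show False
        using \<alpha>\<beta>(3) by contradiction
    qed
    then show ?thesis
      using True card_Un_Int[OF sub(3,4)] by simp
  next
    \<comment> \<open>One of the two has at least \<open>d + 2\<close> elements, and the other
      contributes at least one more.\<close>
    case False
    have "\<not> \<alpha> \<subset> \<beta>" "\<not> \<beta> \<subset> \<alpha>"
      using \<alpha>\<beta> unfolding missing_faces_def by blast+
    then have "\<alpha> \<subset> \<alpha> \<union> \<beta>" "\<beta> \<subset> \<alpha> \<union> \<beta>"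
      using \<alpha>\<beta>(3) by blast+
    then have "card \<alpha> < card (\<alpha> \<union> \<beta>)" "card \<beta> < card (\<alpha> \<union> \<beta>)"
      using sub by (simp_all add: psubset_card_mono)
    then show ?thesis
      using False size[OF \<alpha>\<beta>(1)] size[OF \<alpha>\<beta>(2)] by linarith
  qed
  ultimately show False
    using no_sep[of "\<alpha> \<union> \<beta>"] sub by blast
qed

section \<open>Lower and upper bounds for the number of complexes\<close>

text \<open>Assigning to each missing face a complex that omits it is injective. The predicate
  \<open>P\<close> lets the same count serve Leray and representable complexes.\<close>

lemma card_missing_faces_le:
  assumes X: "abstract_simplicial_complex V X" "partial_steiner_system d n V (missing_faces V X)"
    and int: "is_intersection_of P m V X"
    and P: "\<And>Y. P Y \<Longrightarrow> abstract_simplicial_complex V Y"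
      "\<And>Y U f. P Y \<Longrightarrow> U \<subseteq> V \<Longrightarrow> d + 3 \<le> card U \<Longrightarrow> \<not> separating_colouring Y U f"
  shows "card (missing_faces V X) \<le> m"
proof -
  obtain Y where Y: "\<And>i. i < m \<Longrightarrow> P (Y i)" and X_eq: "X = Pow V \<inter> (\<Inter>i<m. Y i)"
    using int by (auto simp: is_intersection_of_def)
  have "\<exists>i<m. \<tau> \<notin> Y i" if "\<tau> \<in> missing_faces V X" for \<tau>
    using that X_eq by (auto simp: missing_faces_def)
  then obtain c where c: "\<And>\<tau>. \<tau> \<in> missing_faces V X \<Longrightarrow> c \<tau> < m \<and> \<tau> \<notin> Y (c \<tau>)"
    by metis
  have "inj_on c (missing_faces V X)"
  proof (rule inj_onI)
    fix \<tau> \<tau>' assume \<tau>: "\<tau> \<in> missing_faces V X" "\<tau>' \<in> missing_faces V X" "c \<tau> = c \<tau>'"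
    then have "c \<tau> < m" "\<tau> \<notin> Y (c \<tau>)" "\<tau>' \<notin> Y (c \<tau>)"
      using c[of \<tau>] c[of \<tau>'] by simp_all
    then show "\<tau> = \<tau>'"
      using \<tau> P[OF Y[OF \<open>c \<tau> < m\<close>]] X_eq
      by (intro steiner_missing_face_unique[OF X, of "Y (c \<tau>)"]) auto
  qed
  then show ?thesis
    using card_inj_on_le[of c "missing_faces V X" "{..<m}"] c by auto
qed

text \<open>Each missing face contributes the largest complex on \<open>V\<close> that omits
  it.\<close>

lemma is_intersection_of_missing_faces:
  assumes "abstract_simplicial_complex V X"
    and P: "\<And>\<tau>. \<tau> \<in> missing_faces V X \<Longrightarrow> P {\<sigma>. \<sigma> \<subseteq> V \<and> \<not> \<tau> \<subseteq> \<sigma>}"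
  shows "is_intersection_of P (card (missing_faces V X)) V X"
proof -
  let ?M = "missing_faces V X"
  have V: "finite V" and XV: "X \<subseteq> Pow V" and down: "\<And>\<sigma> \<tau>. \<sigma> \<in> X \<Longrightarrow> \<tau> \<subseteq> \<sigma> \<Longrightarrow> \<tau> \<in> X"
    using assms by (auto simp: abstract_simplicial_complex_def)
  have "finite ?M"
    using V by (auto simp: missing_faces_def intro: finite_subset[of _ "Pow V"])
  then obtain h where h: "bij_betw h {..<card ?M} ?M"
    using ex_bij_betw_nat_finite[of ?M] by (auto simp: atLeast0LessThan)
  define Y where "Y i = {\<sigma>. \<sigma> \<subseteq> V \<and> \<not> h i \<subseteq> \<sigma>}" for i
  have "(\<Inter>i<card ?M. Y i) = (\<Inter>\<tau>\<in>?M. {\<sigma>. \<sigma> \<subseteq> V \<and> \<not> \<tau> \<subseteq> \<sigma>})"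
    using h unfolding Y_def bij_betw_def by (metis image_image)
  moreover have "\<sigma> \<in> X \<longleftrightarrow> (\<forall>\<tau>\<in>?M. \<not> \<tau> \<subseteq> \<sigma>)" if "\<sigma> \<subseteq> V" for \<sigma>
    using nonface_contains_missing_face[of \<sigma> V X] finite_subset[OF that V] that down
      missing_face_not_face by metis
  ultimately have "X = Pow V \<inter> (\<Inter>i<card ?M. Y i)"
    using XV by auto
  moreover have "P (Y i)" if "i < card ?M" for i
    using P h that by (auto simp: Y_def bij_betw_def)
  ultimately show ?thesis
    unfolding is_intersection_of_def by blast
qed

section \<open>Representing a complex with one missing face\<close>

text \<open>These are d + 1 convex sets of which any d, but not all, have a common point: facets of
  the unit cube through the origin, and the part with coordinate sum at least 1.\<close>

primrec cube_piece :: "'d::finite option \<Rightarrow> (real ^ 'd) set" where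
  "cube_piece None = cbox 0 1 \<inter> {x. 1 \<bullet> x \<ge> 1}"
| "cube_piece (Some i) = cbox 0 1 \<inter> {x. axis i 1 \<bullet> x = 0}"

lemma cube_piece_compact_convex: "compact (cube_piece j)" "convex (cube_piece j)"
  by (cases j; simp add: closed_halfspace_ge closed_hyperplane compact_Int_closed
      convex_Int convex_halfspace_ge convex_hyperplane)+

lemma Inter_cube_piece: "(\<Inter>j. cube_piece (j :: 'd::finite option)) = {}"
proof (rule ccontr)
  assume "\<not> ?thesis"
  then obtain x :: "real ^ 'd" where x: "\<And>j. x \<in> cube_piece j"
    by blast
  have "x $ i = 0" for i
    using x[of "Some i"] by (simp add: inner_axis')
  then show False
    using x[of None] by (simp add: inner_vec_def)
qed

text \<open>Use the origin when \<open>None\<close> is left out and the k-th unit vector when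
  \<open>Some k\<close> is. The point must lie in the cube, which represents the vertices outside
  the missing face.\<close>

lemma ex_cube_piece:
  fixes j :: "'d::finite option"
  shows "\<exists>x \<in> cbox 0 1. \<forall>i. i \<noteq> j \<longrightarrow> x \<in> cube_piece i"
proof (cases j)
  case None
  have "(0 :: real ^ 'd) \<in> cube_piece i" if "i \<noteq> None" for i
    using that by (auto simp: mem_box_cart)
  then show ?thesis
    using None by (intro bexI[of _ 0]) (auto simp: mem_box_cart)
next
  case (Some k)
  have box: "axis k 1 \<in> cbox (0 :: real ^ 'd) 1"
    by (auto simp: mem_box_cart axis_def)
  have "axis k 1 \<in> cube_piece i" if "i \<noteq> Some k" for i
  proof (cases i)
    case None
    then show ?thesis
      using box by (simp add: inner_axis)
  next
    case (Some l)
    then show ?thesis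
      using box that by (simp add: inner_axis_axis)
  qed
  then show ?thesis
    using Some box by blast
qed

lemma representable_one_missing_face:
  assumes "finite V" "\<tau> \<subseteq> V" "card \<tau> = CARD('d::finite) + 1"
  shows "representable TYPE('d) V {\<sigma>. \<sigma> \<subseteq> V \<and> \<not> \<tau> \<subseteq> \<sigma>}"
proof -
  let ?Y = "{\<sigma>. \<sigma> \<subseteq> V \<and> \<not> \<tau> \<subseteq> \<sigma>}"
  from ex_bij_betw_nat_finite_1[OF \<open>finite V\<close>] obtain h where h: "bij_betw h V {1..card V}"
    using bij_betw_inv by blast
  have "finite \<tau>"
    using assms finite_subset by blast
  then obtain p where p: "bij_betw p \<tau> (UNIV :: 'd option set)"
    using finite_same_card_bij[of \<tau> "UNIV :: 'd option set"] assms by (auto simp: card_UNIV_option)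
  define B where "B v = (if v \<in> \<tau> then cube_piece (p v) else cbox 0 1)" for v
  define F where "F i = B (inv_into V h i)" for i
  have F_h: "F (h v) = B v" if "v \<in> V" for v
    using h that by (simp add: F_def bij_betw_inv_into_left)
  have B_nonempty: "(\<Inter>v\<in>\<sigma>. B v) \<noteq> {} \<longleftrightarrow> \<not> \<tau> \<subseteq> \<sigma>" for \<sigma>
  proof
    assume ne: "(\<Inter>v\<in>\<sigma>. B v) \<noteq> {}"
    show "\<not> \<tau> \<subseteq> \<sigma>"
    proof
      assume "\<tau> \<subseteq> \<sigma>"
      then have "(\<Inter>v\<in>\<sigma>. B v) \<subseteq> (\<Inter>v\<in>\<tau>. B v)"
        by blast
      also have "\<dots> = (\<Inter>v\<in>\<tau>. cube_piece (p v))"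
        by (simp add: B_def)
      also have "\<dots> = (\<Inter>j\<in>p ` \<tau>. cube_piece j)"
        by simp
      also have "\<dots> = {}"
        using p Inter_cube_piece by (simp add: bij_betw_def)
      finally show False
        using ne by simp
    qed
  next
    assume "\<not> \<tau> \<subseteq> \<sigma>"
    then obtain v where v: "v \<in> \<tau>" "v \<notin> \<sigma>"
      by blast
    obtain x where x: "x \<in> cbox 0 1" "\<And>i. i \<noteq> p v \<Longrightarrow> x \<in> cube_piece i"
      using ex_cube_piece[of "p v"] by blast
    have "x \<in> B w" if "w \<in> \<sigma>" for w
    proof (cases "w \<in> \<tau>")
      case True
      then have "p w \<noteq> p v"
        using p v that by (metis bij_betw_imp_inj_on inj_onD)
      then show ?thesis
        using x True by (simp add: B_def)
    qed (use x in \<open>simp add: B_def\<close>)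
    then show "(\<Inter>v\<in>\<sigma>. B v) \<noteq> {}"
      by blast
  qed
  have "\<sigma> \<in> ?Y \<longleftrightarrow> h ` \<sigma> \<in> nerve {1..card V} F" if "\<sigma> \<subseteq> V" for \<sigma>
  proof -
    have "h ` \<sigma> \<subseteq> {1..card V}"
      using h that by (auto simp: bij_betw_def)
    moreover have "(\<Inter>i\<in>h ` \<sigma>. F i) = (\<Inter>v\<in>\<sigma>. B v)"
      using F_h that by auto
    ultimately show ?thesis
      using that B_nonempty by (simp add: nerve_def)
  qed
  then have "isomorphic_complexes V ?Y {1..card V} (nerve {1..card V} F)"
    using h unfolding isomorphic_complexes_def by blast
  moreover have "compact (F i) \<and> convex (F i)" for i
    by (simp add: F_def B_def cube_piece_compact_convex)
  moreover have "abstract_simplicial_complex V ?Y"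
    using assms by (auto simp: abstract_simplicial_complex_def)
  ultimately show ?thesis
    unfolding representable_def by blast
qed

section \<open>The box number\<close>

theorem theorem1p3:
  fixes V :: "'a set" and X :: "'a set set" and d n :: nat
  assumes "1 \<le> d"
    and "CARD('d::finite) = d"
    and "abstract_simplicial_complex V X"
    and "card V = n"
    and "partial_steiner_system d n V (missing_faces V X)"
  shows "(\<forall>m < card (missing_faces V X).
            \<not> is_intersection_of (leray TYPE('f::field) d V) m V X) \<and>
         box_number TYPE('d) V X = enat (card (missing_faces V X))"
proof
  note X = assms(3,5)
  show "\<forall>m < card (missing_faces V X). \<not> is_intersection_of (leray TYPE('f) d V) m V X"
  proof (intro allI impI notI)
    fix m assume "m < card (missing_faces V X)" "is_intersection_of (leray TYPE('f) d V) m V X"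
    moreover from this(2) have "card (missing_faces V X) \<le> m"
    proof (rule card_missing_faces_le[OF X])
      show "abstract_simplicial_complex V Y" if "leray TYPE('f) d V Y" for Y
        using that by (simp add: leray_def)
    qed (rule leray_no_separating_colouring)
    ultimately show False
      by simp
  qed
  let ?K = "{k. is_intersection_of (representable TYPE('d) V) k V X}"
  have "card (missing_faces V X) \<in> ?K"
    using assms by (auto simp: partial_steiner_system_def
        intro!: is_intersection_of_missing_faces representable_one_missing_face)
  moreover have "card (missing_faces V X) \<le> k" if "k \<in> ?K" for k
    using that[unfolded mem_Collect_eq]
  proof (rule card_missing_faces_le[OF X])
    show "abstract_simplicial_complex V Y" if "representable TYPE('d) V Y" for Y
      using that by (simp add: representable_def)
    show "\<not> separating_colouring Y U f"
      if "representable TYPE('d) V Y" "U \<subseteq> V" "d + 3 \<le> card U" for Y U f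
      using representable_no_separating_colouring that assms(2) by blast
  qed
  ultimately show "box_number TYPE('d) V X = enat (card (missing_faces V X))"
    unfolding box_number_def by (intro antisym Inf_lower Inf_greatest) auto
qed

end
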